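(* Let $1\le r<N/2$, $\tau\in\{1,\dots,r+1\}$, let $\mathbf a_0\in\mathbb R^{r+1}$ satisfy $a^{(0)}_\tau=-1$, and let $\mathsf S_0\in\mathcal D_r$ satisfy the GLRR($\mathbf a_0$). Then the parameterization $S_\tau(\dot{\mathbf s},\dot{\mathbf a})$ (defined in the context) is a smooth diffeomorphism between a neighborhood of the point $\big((\mathsf S_0)_{\mathcal I(\tau)},(\mathbf a_0)_{\mathcal K(\tau)}\big)^{\mathrm T}\in\mathbb R^{2r}$ and the intersection of a neighborhood of $\mathsf S_0$ with the set $\mathcal D_r$.
   Context: Time series of length $N$ are vectors in $\mathbb R^N$. For $1\le L\le N$, $T_L:\mathbb R^N\to\mathbb R^{L\times(N-L+1)}$ maps $\mathsf S=(s_1,\dots,s_N)^{\mathrm T}$ to the Hankel matrix with $(i,j)$ entry $s_{i+j-1}$. For $r<N/2$, $\mathcal D_r=\{\mathsf S\in\mathbb R^N:\operatorname{rank}T_{r+1}(\mathsf S)=r\}$. For nonzero $\mathbf a\in\mathbb R^{r+1}$, $\mathsf S$ satisfies (is governed by) GLRR($\mathbf a$) if $\mathbf a^{\mathrm T}T_{r+1}(\mathsf S)=\mathbf 0^{\mathrm T}_{N-r}$; $\mathcal Z(\mathbf a)\subset\mathbb R^N$ is the space of all series of length $N$ governed by GLRR($\mathbf a$). For $\tau\in\{1,\dots,r+1\}$: $\mathcal I(\tau)=\{1,\dots,N\}\setminus\{\tau,\dots,N-r-1+\tau\}$ and $\mathcal K(\tau)=\{1,\dots,r+1\}\setminus\{\tau\}$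 (both have $r$ elements). $\mathbf b_{\mathcal C}$ is the subvector of $\mathbf b$ with indices in $\mathcal C$; $\mathbf B_{\mathcal C,:}$ is the submatrix of rows with indices in $\mathcal C$. $H_\tau:\mathbb R^r\to\mathbb R^{r+1}$ inserts $-1$ at position $\tau$. The parameterization $S_\tau$ near $\mathsf S_0$: for $(\dot{\mathbf s},\dot{\mathbf a})$ in a sufficiently small neighborhood of $\big((\mathsf S_0)_{\mathcal I(\tau)},(\mathbf a_0)_{\mathcal K(\tau)}\big)$, $S_\tau(\dot{\mathbf s},\dot{\mathbf a})$ is the unique series $\mathsf S\in\mathcal D_r$ governed by GLRR($H_\tau(\dot{\mathbf a})$) with $(\mathsf S)_{\mathcal I(\tau)}=\dot{\mathbf s}$. Explicitly, $S_\tau(\dot{\mathbf s},\dot{\mathbf a})=\mathbf Z(\mathbf Z_{\mathcal I(\tau),:})^{-1}\dot{\mathbf s}$, where $\mathbf Z=\mathbf\Pi_{\mathcal Z(H_\tau(\dot{\mathbf a}))}\mathbf Z_0$, the columns of $\mathbf Z_0\in\mathbb R^{N\times r}$ form a basis of $\mathcal Z(\mathbf a_0)$, and $\mathbf\Pi$ denotes orthogonal projection. Smoothness of a map on a subset of $\mathbb R^N$ means that locally it is the restriction of a smooth ($C^\infty$) map defined on an open subset of $\mathbb R^N$; a diffeomorphism is a smooth bijection with smooth inverse.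
   Formalization: The formal theorem additionally assumes that the r×r matrix (Z_0)_{I(τ),:} is invertible; without this, S_τ is undefined at the base point (e.g. N=7, r=2, τ=2, a_0=(1,−1,1), S_0=(0,1,1,0,−1,−1,0)). *)

theory Defs
  imports "HOL-Analysis.Analysis"
begin

text \<open>
  Coordinates are numbered from 1. An index type of class \<open>{finite, linorder}\<close> with \<open>N\<close> elements
  plays the role of \<open>{1, ..., N}\<close> through its unique order isomorphism with that set:
  \<open>pos\<close> maps an index to its number, and \<open>entry v k\<close> is the \<open>k\<close>-th coordinate of \<open>v\<close>.
\<close>

definition nth_of :: "'a::linorder set \<Rightarrow> nat \<Rightarrow> 'a" where
  "nth_of C k = sorted_list_of_set C ! (k - 1)"

definition pos :: "'n::{finite,linorder} \<Rightarrow> nat" where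
  "pos i = card {j. j \<le> i}"

definition entry :: "'a^'n::{finite,linorder} \<Rightarrow> nat \<Rightarrow> 'a" where
  "entry v k = v $ nth_of UNIV k"

text \<open>
  \<open>b\<^sub>C\<close> and \<open>B\<^sub>C\<^sub>,\<^sub>:\<close> for a set \<open>C\<close> of coordinate numbers; meaningful when the index type
  \<open>'r\<close> of the result has \<open>card C\<close> elements.
\<close>

definition subvec :: "nat set \<Rightarrow> 'a^'n::{finite,linorder} \<Rightarrow> 'a^'r::{finite,linorder}" where
  "subvec C b = (\<chi> k. entry b (nth_of C (pos k)))"

definition subrows :: "nat set \<Rightarrow> 'a^'c^'n::{finite,linorder} \<Rightarrow> 'a^'c^'r::{finite,linorder}" where
  "subrows C B = (\<chi> k. entry B (nth_of C (pos k)))"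

definition I_set :: "nat \<Rightarrow> nat \<Rightarrow> nat \<Rightarrow> nat set" where
  "I_set N r \<tau> = {1..N} - {\<tau>..N - r - 1 + \<tau>}"

definition K_set :: "nat \<Rightarrow> nat \<Rightarrow> nat set" where
  "K_set r \<tau> = {1..r + 1} - {\<tau>}"

definition insert_minus_one ::
    "nat \<Rightarrow> real^'r::{finite,linorder} \<Rightarrow> real^'m::{finite,linorder}" where
  "insert_minus_one \<tau> a =
     (\<chi> i. if pos i < \<tau> then entry a (pos i) else if pos i = \<tau> then -1 else entry a (pos i - 1))"

text \<open>
  The window length \<open>L\<close> is the number of rows, so \<open>hankel\<close> is \<open>T\<^sub>L\<close> when \<open>'l\<close> has \<open>L\<close> and \<open>'k\<close> has
  \<open>N - L + 1\<close> elements. The sets below take the index types of the columns and rows as arguments, because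
  the type of the series alone does not determine the dimensions of the trajectory matrix.
\<close>

definition hankel ::
    "real^'n::{finite,linorder} \<Rightarrow> real^'k::{finite,linorder}^'l::{finite,linorder}" where
  "hankel S = (\<chi> i j. entry S (pos i + pos j - 1))"

definition rank_series :: "'k::{finite,linorder} itself \<Rightarrow> 'm::{finite,linorder} itself \<Rightarrow> nat
    \<Rightarrow> (real^'n::{finite,linorder}) set" where
  "rank_series _ _ r = {S. rank (hankel S :: real^'k::{finite,linorder}^'m::{finite,linorder}) = r}"

definition governed_series :: "'k::{finite,linorder} itself
    \<Rightarrow> real^'m::{finite,linorder} \<Rightarrow> (real^'n::{finite,linorder}) set" where
  "governed_series _ a =
     {S. a v* (hankel S :: real^'k::{finite,linorder}^'m::{finite,linorder}) = 0}"

definition orth_proj :: "'a::euclidean_space set \<Rightarrow> 'a \<Rightarrow> 'a" where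
  "orth_proj V x = (THE y. y \<in> V \<and> (\<forall>v\<in>V. orthogonal (x - y) v))"

definition columns_basis :: "real^'r^'n \<Rightarrow> (real^'n) set \<Rightarrow> bool" where
  "columns_basis Z V \<longleftrightarrow>
     inj (\<lambda>j. column j Z) \<and> independent (columns Z) \<and> span (columns Z) = V"

text \<open>
  The local parameterization \<open>S\<^sub>\<tau>\<close>, in its explicit form; the columns of \<open>Z0\<close> are a basis of the
  series governed by \<open>a\<^sub>0\<close>.
\<close>

definition param :: "'k::{finite,linorder} itself \<Rightarrow> 'm::{finite,linorder} itself \<Rightarrow> nat
    \<Rightarrow> real^'r::{finite,linorder}^'n::{finite,linorder}
    \<Rightarrow> (real^'r::{finite,linorder}) \<times> (real^'r::{finite,linorder})
    \<Rightarrow> real^'n::{finite,linorder}" where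
  "param _ _ \<tau> Z0 = (\<lambda>(s, a).
     let V = governed_series TYPE('k) (insert_minus_one \<tau> a :: real^'m::{finite,linorder});
         Z = matrix (orth_proj V) ** Z0
     in Z *v (matrix_inv (subrows (I_set CARD('n) CARD('r) \<tau>) Z) *v s))"

text \<open>
  \<open>Ck n f U\<close>: \<open>f\<close> is \<open>n\<close> times continuously differentiable on the open set \<open>U\<close>
  (all iterated directional derivatives up to order \<open>n\<close> exist and are continuous).
\<close>

primrec Ck :: "nat \<Rightarrow> ('a::euclidean_space \<Rightarrow> 'b::euclidean_space) \<Rightarrow> 'a set \<Rightarrow> bool" where
  "Ck 0 f U \<longleftrightarrow> continuous_on U f"
| "Ck (Suc n) f U \<longleftrightarrow>
     (\<forall>x\<in>U. f differentiable (at x)) \<and> (\<forall>v. Ck n (\<lambda>x. frechet_derivative f (at x) v) U)"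

definition smooth_on_open :: "('a::euclidean_space \<Rightarrow> 'b::euclidean_space) \<Rightarrow> 'a set \<Rightarrow> bool" where
  "smooth_on_open f U \<longleftrightarrow> open U \<and> (\<forall>n. Ck n f U)"

definition smooth_on_subset :: "('a::euclidean_space \<Rightarrow> 'b::euclidean_space) \<Rightarrow> 'a set \<Rightarrow> bool" where
  "smooth_on_subset f X \<longleftrightarrow>
     (\<forall>x\<in>X. \<exists>U g. x \<in> U \<and> smooth_on_open g U \<and> (\<forall>y\<in>X \<inter> U. f y = g y))"

definition diffeomorphism_betw ::
    "('a::euclidean_space \<Rightarrow> 'b::euclidean_space) \<Rightarrow> 'a set \<Rightarrow> 'b set \<Rightarrow> bool" where
  "diffeomorphism_betw f X Y \<longleftrightarrow>
     bij_betw f X Y \<and> smooth_on_subset f X \<and> smooth_on_subset (inv_into X f) Y"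

end

theory Submission
  imports Defs
begin

text \<open>
  For fixed \<open>a\<close>, the conditions ``governed by \<open>H\<^sub>\<tau> a\<close>'' and ``coordinates in \<open>I(\<tau>)\<close> equal \<open>s\<close>'' form one
  square linear system in the series, whose matrix is affine in \<open>a\<close> and nonsingular at \<open>a\<^sub>0\<close>. By
  Cramer's rule its solution is a rational function of \<open>(s, a)\<close>, and it agrees with the explicit
  formula by projection wherever the latter makes sense. Conversely, near \<open>S\<^sub>0\<close> the rows of the
  trajectory matrix other than row \<open>\<tau>\<close> stay linearly independent, so on \<open>D\<^sub>r\<close> the recurrence is
  recovered from the series by the normal equations, again a rational function. These two maps are
  inverse to each other, and rational functions are smooth where their denominators do not vanish.
\<close>

section \<open>Smoothness of rational maps\<close>

text \<open>This class is closed under directional derivatives, which makes its members \<open>C\<^sup>n\<close> for all \<open>n\<close> at once.\<close>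
inductive rational_on :: "'a::euclidean_space set \<Rightarrow> ('a \<Rightarrow> real) \<Rightarrow> bool" for U where
  rational_const: "rational_on U (\<lambda>x. c)"
| rational_linear: "bounded_linear f \<Longrightarrow> rational_on U f"
| rational_add: "rational_on U f \<Longrightarrow> rational_on U g \<Longrightarrow> rational_on U (\<lambda>x. f x + g x)"
| rational_mult: "rational_on U f \<Longrightarrow> rational_on U g \<Longrightarrow> rational_on U (\<lambda>x. f x * g x)"
| rational_inverse: "rational_on U f \<Longrightarrow> (\<And>x. x \<in> U \<Longrightarrow> f x \<noteq> 0) \<Longrightarrow> rational_on U (\<lambda>x. inverse (f x))"

lemma rational_on_subset: "rational_on U f \<Longrightarrow> V \<subseteq> U \<Longrightarrow> rational_on V f"
  by (induction rule: rational_on.induct) (auto intro: rational_on.intros)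

lemma rational_minus: "rational_on U f \<Longrightarrow> rational_on U (\<lambda>x. - f x)"
  using rational_mult[OF rational_const[of U "-1"], of f] by simp

lemma rational_sum: "(\<And>i. i \<in> I \<Longrightarrow> rational_on U (f i)) \<Longrightarrow> rational_on U (\<lambda>x. \<Sum>i\<in>I. f i x)"
  by (induction I rule: infinite_finite_induct) (auto intro: rational_on.intros)

lemma rational_prod: "(\<And>i. i \<in> I \<Longrightarrow> rational_on U (f i)) \<Longrightarrow> rational_on U (\<lambda>x. \<Prod>i\<in>I. f i x)"
  by (induction I rule: infinite_finite_induct) (auto intro: rational_on.intros)

lemma rational_divide:
  "rational_on U f \<Longrightarrow> rational_on U g \<Longrightarrow> (\<And>x. x \<in> U \<Longrightarrow> g x \<noteq> 0) \<Longrightarrow> rational_on U (\<lambda>x. f x / g x)"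
  unfolding divide_inverse by (intro rational_mult rational_inverse)

text \<open>One \<open>f'\<close> serves all points and all directions, so that for a fixed
  direction \<open>v\<close> the map \<open>\<lambda>x. f' x v\<close> is again rational. This
  closure drives the induction on the order of differentiability.\<close>

lemma rational_on_derivative:
  assumes "rational_on U f"
  shows "\<exists>f'. (\<forall>x\<in>U. (f has_derivative f' x) (at x)) \<and> (\<forall>v. rational_on U (\<lambda>x. f' x v))"
  using assms
proof (induction rule: rational_on.induct)
  case (rational_const c)
  show ?case
    by (rule exI[of _ "\<lambda>x v. 0"]) (auto intro: rational_on.intros)
next
  case (rational_linear f)
  then show ?case
    by (intro exI[of _ "\<lambda>x. f"]) (auto intro: rational_on.intros bounded_linear_imp_has_derivative)
next
  case (rational_add f g)
  then obtain f' g' where "\<forall>x\<in>U. (f has_derivative f' x) (at x)" "\<forall>v. rational_on U (\<lambda>x. f' x v)"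
    "\<forall>x\<in>U. (g has_derivative g' x) (at x)" "\<forall>v. rational_on U (\<lambda>x. g' x v)"
    by blast
  then show ?case
    by (intro exI[of _ "\<lambda>x v. f' x v + g' x v"])
      (auto intro!: rational_on.rational_add has_derivative_add)
next
  case (rational_mult f g)
  then obtain f' g' where "\<forall>x\<in>U. (f has_derivative f' x) (at x)" "\<forall>v. rational_on U (\<lambda>x. f' x v)"
    "\<forall>x\<in>U. (g has_derivative g' x) (at x)" "\<forall>v. rational_on U (\<lambda>x. g' x v)"
    by blast
  with rational_mult show ?case
    by (intro exI[of _ "\<lambda>x v. f x * g' x v + f' x v * g x"])
      (auto intro!: rational_on.rational_mult rational_on.rational_add has_derivative_mult)
next
  case (rational_inverse f)
  then obtain f' where "\<forall>x\<in>U. (f has_derivative f' x) (at x)" "\<forall>v. rational_on U (\<lambda>x. f' x v)"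
    by blast
  with rational_inverse show ?case
    by (intro exI[of _ "\<lambda>x v. - (inverse (f x) * f' x v * inverse (f x))"] conjI ballI allI)
      (auto intro!: rational_minus rational_on.rational_mult rational_on.rational_inverse
         has_derivative_inverse)
qed

lemma continuous_on_rational: "rational_on U f \<Longrightarrow> continuous_on U f"
  using rational_on_derivative by (blast intro: continuous_at_imp_continuous_on has_derivative_continuous)

text \<open>\<open>Ck\<close> refers to \<open>frechet_derivative\<close>, which depends only on the
  function near the point; as \<open>U\<close> is open, agreement on \<open>U\<close> carries over
  to every order.\<close>

lemma Ck_cong:
  assumes "open U" "\<And>x. x \<in> U \<Longrightarrow> f x = g x" "Ck n f U"
  shows "Ck n g U"
  using assms
proof (induction n arbitrary: f g)
  case 0
  then show ?case by (auto intro: continuous_on_eq)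
next
  case (Suc n)
  have "frechet_derivative f (at x) = frechet_derivative g (at x)" if "x \<in> U" for x
    using Suc.prems that frechet_derivative_transform_within_open[of f x U g] by auto
  moreover have "g differentiable (at x)" if "x \<in> U" for x
  proof -
    from Suc.prems(3) that obtain D where "(f has_derivative D) (at x)"
      by (auto simp: differentiable_def)
    then have "(g has_derivative D) (at x)"
      by (rule has_derivative_transform_within_open[OF _ \<open>open U\<close> that]) (rule Suc.prems(2))
    then show ?thesis by (auto simp: differentiable_def)
  qed
  moreover have "Ck n (\<lambda>x. frechet_derivative g (at x) v) U" for v
    by (rule Suc.IH[OF \<open>open U\<close>, of "\<lambda>x. frechet_derivative f (at x) v"])
      (use Suc.prems(3) calculation(1) in simp_all)
  ultimately show ?case
    by simp
qed

text \<open>The induction runs over all \<open>f\<close> at once because the directional derivatives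
  are new rational functions. \<open>Ck_cong\<close> exchanges the derivative from
  \<open>rational_on_derivative\<close>, known only on \<open>U\<close>, for
  \<open>frechet_derivative\<close>.\<close>

lemma Ck_rational: "open U \<Longrightarrow> rational_on U f \<Longrightarrow> Ck n f U"
proof (induction n arbitrary: f)
  case 0
  then show ?case by (simp add: continuous_on_rational)
next
  case (Suc n)
  obtain f' where f': "\<And>x. x \<in> U \<Longrightarrow> (f has_derivative f' x) (at x)" "\<And>v. rational_on U (\<lambda>x. f' x v)"
    using rational_on_derivative[OF Suc.prems(2)] by blast
  have eq: "f' x v = frechet_derivative f (at x) v" if "x \<in> U" for x v
    using frechet_derivative_at[OF f'(1)[OF that]] by simp
  have "Ck n (\<lambda>x. frechet_derivative f (at x) v) U" for v
  proof (rule Ck_cong[OF Suc.prems(1)])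
    show "Ck n (\<lambda>x. f' x v) U" by (rule Suc.IH[OF Suc.prems(1) f'(2)])
  qed (rule eq)
  moreover have "f differentiable (at x)" if "x \<in> U" for x
    using f'(1)[OF that] by (auto simp: differentiable_def)
  ultimately show ?case by simp
qed

text \<open>Differentiation commutes with taking a coordinate, so the derivative in a fixed
  direction has coordinates of one order less and the induction hypothesis applies to it.\<close>

lemma Ck_componentwise:
  fixes f :: "'a::euclidean_space \<Rightarrow> 'b::euclidean_space"
  assumes "open U" "\<And>b. b \<in> Basis \<Longrightarrow> Ck n (\<lambda>x. f x \<bullet> b) U"
  shows "Ck n f U"
  using assms
proof (induction n arbitrary: f)
  case 0
  then show ?case by (auto intro: continuous_on_componentwise[THEN iffD2])
next
  case (Suc n)
  have diff: "f differentiable (at x)" if "x \<in> U" for x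
    using Suc.prems that by (subst differentiable_componentwise_within) auto
  have "Ck n (\<lambda>x. frechet_derivative f (at x) v) U" for v
  proof (rule Suc.IH[OF \<open>open U\<close>])
    fix b :: 'b assume b: "b \<in> Basis"
    have "frechet_derivative (\<lambda>x. f x \<bullet> b) (at x) v = frechet_derivative f (at x) v \<bullet> b"
      if "x \<in> U" for x
    proof -
      have "((\<lambda>x. f x \<bullet> b) has_derivative (\<lambda>v. frechet_derivative f (at x) v \<bullet> b)) (at x)"
        using diff[OF that] by (intro has_derivative_inner_left) (simp add: frechet_derivative_works)
      from frechet_derivative_at[OF this] show ?thesis by metis
    qed
    then show "Ck n (\<lambda>x. frechet_derivative f (at x) v \<bullet> b) U"
      by (rule Ck_cong[OF Suc.prems(1)]) (use Suc.prems(2)[OF b] in simp_all)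
  qed
  then show ?case using diff by simp
qed

lemma smooth_on_open_rational:
  fixes f :: "'a::euclidean_space \<Rightarrow> 'b::euclidean_space"
  assumes "open U" "\<And>b. b \<in> Basis \<Longrightarrow> rational_on U (\<lambda>x. f x \<bullet> b)"
  shows "smooth_on_open f U"
  using assms unfolding smooth_on_open_def by (auto intro: Ck_componentwise Ck_rational)

lemma smooth_on_subsetI:
  assumes "smooth_on_open g W" "X \<subseteq> W" "\<And>x. x \<in> X \<Longrightarrow> f x = g x"
  shows "smooth_on_subset f X"
  using assms unfolding smooth_on_subset_def by blast

lemma continuous_on_rational_components:
  fixes f :: "'a::euclidean_space \<Rightarrow> 'b::euclidean_space"
  assumes "\<And>b. b \<in> Basis \<Longrightarrow> rational_on U (\<lambda>x. f x \<bullet> b)"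
  shows "continuous_on U f"
  using assms by (auto intro: continuous_on_componentwise[THEN iffD2] continuous_on_rational)

text \<open>The sets \<open>U1\<close>, \<open>U2\<close>, \<open>U\<close> and \<open>W\<close> of
  the main theorem are all carved out by a condition of this shape.\<close>

lemma open_rational_nonzero:
  assumes "open U" "rational_on U f"
  shows "open {x \<in> U. f x \<noteq> 0}"
  using continuous_open_preimage[OF continuous_on_rational[OF assms(2)] assms(1), of "- {0}"]
  by (simp add: vimage_def Int_def open_delete Compl_eq_Diff_UNIV)

section \<open>Determinants and linear systems with rational entries\<close>

lemma rational_det:
  fixes A :: "'a::euclidean_space \<Rightarrow> real^'n^'n"
  assumes "\<And>i j. rational_on U (\<lambda>x. A x $ i $ j)"
  shows "rational_on U (\<lambda>x. det (A x))"
  unfolding det_def using assms by (intro rational_sum rational_mult rational_prod rational_const)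

text \<open>Cramer's quotients rather than \<open>matrix_inv A *v b\<close>, so that rationality in
  the entries of \<open>A\<close> and \<open>b\<close> can be read off. For singular
  \<open>A\<close> the value is 0, by the convention for division.\<close>

definition lin_solve :: "real^'n^'n \<Rightarrow> real^'n \<Rightarrow> real^'n" where
  "lin_solve A b = (\<chi> k. det (\<chi> i j. if j = k then b $ i else A $ i $ j) / det A)"

lemma lin_solve_iff: "det A \<noteq> 0 \<Longrightarrow> A *v x = b \<longleftrightarrow> x = lin_solve A b"
  unfolding lin_solve_def by (rule cramer)

lemma rational_lin_solve:
  assumes "\<And>i j. rational_on U (\<lambda>x. A x $ i $ j)" "\<And>i. rational_on U (\<lambda>x. b x $ i)"
    and "\<And>x. x \<in> U \<Longrightarrow> det (A x) \<noteq> 0"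
  shows "rational_on U (\<lambda>x. lin_solve (A x) (b x) $ k)"
proof -
  have "rational_on U (\<lambda>x. if j = k then b x $ i else A x $ i $ j)" for i j k
    using assms by (cases "j = k") simp_all
  then show ?thesis
    unfolding lin_solve_def using assms by (simp add: rational_divide rational_det)
qed

lemma det_nonzero_iff_kernel: "det A \<noteq> 0 \<longleftrightarrow> (\<forall>x. A *v x = 0 \<longrightarrow> x = 0)" for A :: "real^'n^'n"
  by (metis invertible_det_nz invertible_left_inverse matrix_left_invertible_ker)

lemma rational_vec_components:
  assumes "\<And>k. rational_on U (\<lambda>x. f x $ k)" "b \<in> Basis"
  shows "rational_on U (\<lambda>x. (f x :: real^'n) \<bullet> b)"
  using assms by (auto simp: Basis_vec_def inner_axis)

lemma rational_pair_components:
  fixes f :: "'a::euclidean_space \<Rightarrow> (real^'n) \<times> (real^'m)"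
  assumes "\<And>k. rational_on U (\<lambda>x. fst (f x) $ k)" "\<And>k. rational_on U (\<lambda>x. snd (f x) $ k)" "b \<in> Basis"
  shows "rational_on U (\<lambda>x. f x \<bullet> b)"
  using assms by (auto simp: Basis_prod_def inner_prod_def rational_vec_components)

section \<open>Orthogonal projection\<close>

text \<open>The definite description needs existence, which is the orthogonal decomposition, and
  uniqueness: two candidates differ by a vector of \<open>V\<close> that is orthogonal to
  itself.\<close>

lemma orth_proj_works:
  assumes "subspace V"
  shows "orth_proj V x \<in> V \<and> (\<forall>v\<in>V. orthogonal (x - orth_proj V x) v)"
proof -
  obtain y z where "y \<in> V" "\<And>w. w \<in> V \<Longrightarrow> orthogonal z w" "x = y + z"
    using orthogonal_subspace_decomp_exists[of V x] unfolding span_eq_iff[THEN iffD2, OF assms] by blast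
  then have ex: "y \<in> V \<and> (\<forall>v\<in>V. orthogonal (x - y) v)" by simp
  have uniq: "y' = y" if "y' \<in> V \<and> (\<forall>v\<in>V. orthogonal (x - y') v)" for y'
  proof -
    have "y' - y \<in> V" using that ex assms by (simp add: subspace_diff)
    then have "(x - y) \<bullet> (y' - y) = 0" "(x - y') \<bullet> (y' - y) = 0"
      using that ex by (auto simp: orthogonal_def)
    then have "(y' - y) \<bullet> (y' - y) = 0" by (simp add: inner_diff_left)
    then show ?thesis by simp
  qed
  have "orth_proj V x = y"
    unfolding orth_proj_def by (rule the_equality) (fact ex, fact uniq)
  with ex show ?thesis by simp
qed

lemma orth_proj_eqI:
  assumes "subspace V" "y \<in> V" "\<And>v. v \<in> V \<Longrightarrow> orthogonal (x - y) v"
  shows "orth_proj V x = y"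
proof -
  define p where "p = orth_proj V x"
  have p: "p \<in> V" "\<And>v. v \<in> V \<Longrightarrow> orthogonal (x - p) v"
    unfolding p_def using orth_proj_works[OF assms(1), of x] by blast+
  have d: "y - p \<in> V" by (intro subspace_diff assms p)
  have "(x - y) \<bullet> (y - p) = 0" "(x - p) \<bullet> (y - p) = 0"
    using assms(3)[OF d] p(2)[OF d] by (simp_all add: orthogonal_def)
  then have "(y - p) \<bullet> (y - p) = 0" by (simp add: inner_diff_left)
  then show ?thesis by (simp add: p_def)
qed

lemma linear_orth_proj:
  assumes "subspace V"
  shows "linear (orth_proj V)"
proof (rule linearI)
  fix x y :: 'a and c :: real
  have w: "orth_proj V z \<in> V" "\<And>v. v \<in> V \<Longrightarrow> (z - orth_proj V z) \<bullet> v = 0" for z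
    using orth_proj_works[OF assms, of z] by (simp_all add: orthogonal_def)
  show "orth_proj V (x + y) = orth_proj V x + orth_proj V y"
  proof (rule orth_proj_eqI[OF assms])
    show "orth_proj V x + orth_proj V y \<in> V" by (intro subspace_add assms w(1))
    show "orthogonal (x + y - (orth_proj V x + orth_proj V y)) v" if "v \<in> V" for v
      using w(2)[OF that, of x] w(2)[OF that, of y] by (simp add: orthogonal_def inner_simps)
  qed
  show "orth_proj V (c *\<^sub>R x) = c *\<^sub>R orth_proj V x"
  proof (rule orth_proj_eqI[OF assms])
    show "c *\<^sub>R orth_proj V x \<in> V" by (intro subspace_scale assms w(1))
    show "orthogonal (c *\<^sub>R x - c *\<^sub>R orth_proj V x) v" if "v \<in> V" for v
      using w(2)[OF that, of x] by (simp add: orthogonal_def inner_simps)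
  qed
qed

section \<open>Column space, left kernel and rows of a matrix\<close>

lemma columns_basis_range:
  assumes "columns_basis Z V"
  shows "range ((*v) Z) = V"
proof
  have V: "span (columns Z) = V" using assms by (simp add: columns_basis_def)
  show "range ((*v) Z) \<subseteq> V" using matrix_vector_mult_in_columnspace[of Z] V by auto
  have "columns Z \<subseteq> range ((*v) Z)" by (auto simp: columns_image_basis)
  moreover have "subspace (range ((*v) Z))"
    by (rule linear_subspace_image[OF matrix_vector_mul_linear subspace_UNIV])
  ultimately show "V \<subseteq> range ((*v) Z)" using V span_minimal by blast
qed

lemma det_nonzero_iff_left_kernel:
  "det A \<noteq> 0 \<longleftrightarrow> (\<forall>x. x v* A = 0 \<longrightarrow> x = 0)" for A :: "real^'n^'n"
  using det_nonzero_iff_kernel[of "transpose A"] by (simp add: det_transpose)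

lemma rows_eq_range: "rows A = range (($) A)"
  by (auto simp: rows_def row_def)

section \<open>Index sets\<close>

lemma pos_strict_mono: "i < j \<Longrightarrow> pos i < pos j" for i j :: "'n::{finite,linorder}"
  unfolding pos_def by (rule psubset_card_mono) force+

lemma inj_pos: "inj (pos :: 'n::{finite,linorder} \<Rightarrow> nat)"
  by (metis injI less_irrefl linorder_neqE pos_strict_mono)

lemma pos_in: "pos (i::'n::{finite,linorder}) \<in> {1..CARD('n)}"
proof -
  have "card {j. j \<le> i} \<le> CARD('n)" by (rule card_mono) auto
  moreover have "card {j. j \<le> i} > 0" by (auto simp: card_gt_0_iff)
  ultimately show ?thesis unfolding pos_def by simp
qed

lemma range_pos: "range (pos :: 'n::{finite,linorder} \<Rightarrow> nat) = {1..CARD('n)}"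
proof (rule card_subset_eq)
  show "range (pos :: 'n \<Rightarrow> nat) \<subseteq> {1..CARD('n)}" using pos_in by blast
qed (simp_all add: card_image inj_pos)

section \<open>Increasing enumeration of a finite set\<close>

lemma nth_of_less: "finite C \<Longrightarrow> 1 \<le> k \<Longrightarrow> k < l \<Longrightarrow> l \<le> card C \<Longrightarrow> nth_of C k < nth_of C l"
  unfolding nth_of_def
  by (rule sorted_wrt_nth_less[OF strict_sorted_list_of_set]) auto

lemma nth_of_inj_on: "finite C \<Longrightarrow> inj_on (nth_of C) {1..card C}"
  by (rule linorder_inj_onI) (force dest: nth_of_less)+

lemma nth_of_image: "finite C \<Longrightarrow> nth_of C ` {1..card C} = C"
proof (rule card_subset_eq)
  assume C: "finite C"
  show "nth_of C ` {1..card C} \<subseteq> C"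
  proof safe
    fix k assume "k \<in> {1..card C}"
    then have "sorted_list_of_set C ! (k - 1) \<in> set (sorted_list_of_set C)"
      by (intro nth_mem) auto
    then show "nth_of C k \<in> C" using C by (simp add: nth_of_def)
  qed
  show "card (nth_of C ` {1..card C}) = card C"
    using card_image[OF nth_of_inj_on[OF C]] by simp
qed

text \<open>Counting the elements up to \<open>x\<close> identifies its place without computing the
  sorted list; this serves both \<open>UNIV\<close> and \<open>K_set\<close>.\<close>

lemma nth_of_eqI:
  assumes "finite C" "x \<in> C" "card {y \<in> C. y \<le> x} = k"
  shows "nth_of C k = x"
proof -
  obtain l where l: "l \<in> {1..card C}" "x = nth_of C l"
    using nth_of_image[OF assms(1)] assms(2) by blast
  have le: "nth_of C j \<le> nth_of C l \<longleftrightarrow> j \<le> l" if "j \<in> {1..card C}" for j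
    using that l nth_of_less[OF assms(1), of j l] nth_of_less[OF assms(1), of l j]
    by (cases j l rule: linorder_cases) auto
  have "{y \<in> C. y \<le> x} = nth_of C ` {1..l}"
  proof
    show "{y \<in> C. y \<le> x} \<subseteq> nth_of C ` {1..l}"
    proof safe
      fix y assume "y \<in> C" "y \<le> x"
      then obtain j where "j \<in> {1..card C}" "y = nth_of C j"
        using nth_of_image[OF assms(1)] by blast
      with le[of j] \<open>y \<le> x\<close> l show "y \<in> nth_of C ` {1..l}" by simp
    qed
    show "nth_of C ` {1..l} \<subseteq> {y \<in> C. y \<le> x}"
    proof safe
      fix j assume "j \<in> {1..l}"
      with l have j: "j \<in> {1..card C}" "j \<le> l" by auto
      show "nth_of C j \<in> C" using nth_of_image[OF assms(1)] j(1) by blast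
      show "nth_of C j \<le> x" using le[OF j(1)] j(2) l(2) by simp
    qed
  qed
  moreover have "inj_on (nth_of C) {1..l}"
    using nth_of_inj_on[OF assms(1)] l by (auto intro: inj_on_subset)
  ultimately have "k = l" using assms(3) by (simp add: card_image)
  then show ?thesis using l by simp
qed

lemma nth_of_pos [simp]: "nth_of UNIV (pos i) = i" for i :: "'n::{finite,linorder}"
  by (rule nth_of_eqI) (auto simp: pos_def)

lemma pos_nth_of: "k \<in> {1..CARD('n)} \<Longrightarrow> pos (nth_of UNIV k :: 'n::{finite,linorder}) = k"
  by (metis nth_of_pos imageE range_pos)

text \<open>Carries the enumeration of \<open>C\<close> back to the index type, so that
  \<open>subvec\<close> and \<open>subrows\<close> become plain reindexing.\<close>

definition sel :: "nat set \<Rightarrow> 'r::{finite,linorder} \<Rightarrow> 'n::{finite,linorder}" where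
  "sel C k = nth_of UNIV (nth_of C (pos k))"

lemma subvec_nth: "subvec C b $ k = b $ sel C k"
  by (simp add: subvec_def entry_def sel_def)

lemma subrows_nth: "subrows C B $ k = B $ sel C k"
  by (simp add: subrows_def entry_def sel_def)

lemma
  assumes "C \<subseteq> {1..CARD('n)}" "card C = CARD('r)"
  shows pos_sel: "pos (sel C (k :: 'r::{finite,linorder}) :: 'n::{finite,linorder}) = nth_of C (pos k)"
    and inj_sel: "inj (sel C :: 'r \<Rightarrow> 'n)"
    and range_sel: "range (sel C :: 'r \<Rightarrow> 'n) = {p. pos p \<in> C}"
proof -
  have fin: "finite C" using assms(1) finite_subset by blast
  have im: "range (\<lambda>k::'r. nth_of C (pos k)) = C"
    using nth_of_image[OF fin] range_pos[where 'n='r] assms(2) by (metis image_image)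
  show ps: "pos (sel C k :: 'n) = nth_of C (pos k)" for k :: 'r
    unfolding sel_def by (rule pos_nth_of) (use im assms(1) in blast)
  \<comment> \<open>A map from \<open>'r\<close> onto a set of \<open>CARD('r)\<close> elements is
    injective.\<close>
  have "inj (\<lambda>k::'r. nth_of C (pos k))"
    using im assms(2) by (metis eq_card_imp_inj_on finite)
  then show "inj (sel C :: 'r \<Rightarrow> 'n)"
    using ps by (metis (mono_tags, lifting) injD injI)
  show "range (sel C :: 'r \<Rightarrow> 'n) = {p. pos p \<in> C}"
  proof
    show "range (sel C :: 'r \<Rightarrow> 'n) \<subseteq> {p. pos p \<in> C}" using ps im by auto
    show "{p. pos p \<in> C} \<subseteq> range (sel C :: 'r \<Rightarrow> 'n)"
    proof safe
      fix p :: 'n assume "pos p \<in> C"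
      then obtain k :: 'r where "pos p = nth_of C (pos k)" using im by blast
      then have "p = sel C k" using ps[of k] inj_pos by (metis injD)
      then show "p \<in> range (sel C :: 'r \<Rightarrow> 'n)" by blast
    qed
  qed
qed

lemma I_set_sub: "I_set N r \<tau> \<subseteq> {1..N}"
  by (auto simp: I_set_def)

lemma card_I_set: "2 * r < N \<Longrightarrow> \<tau> \<in> {1..r + 1} \<Longrightarrow> card (I_set N r \<tau>) = r"
  unfolding I_set_def by (subst card_Diff_subset) auto

lemma K_set_sub: "K_set r \<tau> \<subseteq> {1..r + 1}"
  by (auto simp: K_set_def)

lemma card_K_set: "\<tau> \<in> {1..r + 1} \<Longrightarrow> card (K_set r \<tau>) = r"
  unfolding K_set_def by simp

text \<open>The shift by one beyond \<open>\<tau>\<close> is the one inside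
  \<open>insert_minus_one\<close>, so selecting the coordinates in \<open>K(\<tau>)\<close> undoes
  the insertion.\<close>

lemma nth_of_K_set:
  assumes "\<tau> \<in> {1..r + 1}" "k \<in> {1..r}"
  shows "nth_of (K_set r \<tau>) k = (if k < \<tau> then k else k + 1)"
proof (rule nth_of_eqI)
  show "(if k < \<tau> then k else k + 1) \<in> K_set r \<tau>" using assms by (auto simp: K_set_def)
  have "{y \<in> K_set r \<tau>. y \<le> (if k < \<tau> then k else k + 1)} = (if k < \<tau> then {1..k} else {1..k + 1} - {\<tau>})"
    using assms by (auto simp: K_set_def)
  then show "card {y \<in> K_set r \<tau>. y \<le> (if k < \<tau> then k else k + 1)} = k"
    using assms by auto
qed (simp add: K_set_def)

lemma
  fixes a :: "real^'r::{finite,linorder}"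
  assumes "CARD('m::{finite,linorder}) = CARD('r) + 1" "\<tau> \<in> {1..CARD('r) + 1}"
  shows insert_minus_one_sel:
      "(insert_minus_one \<tau> a :: real^'m::{finite,linorder}) $ sel (K_set CARD('r) \<tau>) l = a $ l"
    and insert_minus_one_at: "(insert_minus_one \<tau> a :: real^'m::{finite,linorder}) $ nth_of UNIV \<tau> = -1"
    and range_sel_K: "range (sel (K_set CARD('r) \<tau>) :: 'r \<Rightarrow> 'm::{finite,linorder}) = - {nth_of UNIV \<tau>}"
    and inj_sel_K: "inj (sel (K_set CARD('r) \<tau>) :: 'r \<Rightarrow> 'm::{finite,linorder})"
proof -
  have sub: "K_set CARD('r) \<tau> \<subseteq> {1..CARD('m::{finite,linorder})}" "card (K_set CARD('r) \<tau>) = CARD('r)"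
    using K_set_sub[of "CARD('r)" \<tau>] card_K_set[OF assms(2)] assms(1) by simp_all
  have tau: "pos (nth_of UNIV \<tau> :: 'm::{finite,linorder}) = \<tau>" using assms by (intro pos_nth_of) simp
  then show "(insert_minus_one \<tau> a :: real^'m::{finite,linorder}) $ nth_of UNIV \<tau> = -1"
    by (simp add: insert_minus_one_def)
  have "pos (sel (K_set CARD('r) \<tau>) l :: 'm::{finite,linorder}) = (if pos l < \<tau> then pos l else pos l + 1)" for l :: 'r
    using pos_sel[OF sub, of l] nth_of_K_set[OF assms(2), of "pos l"] pos_in[of l] by metis
  then show "(insert_minus_one \<tau> a :: real^'m::{finite,linorder}) $ sel (K_set CARD('r) \<tau>) l = a $ l"
    by (simp add: insert_minus_one_def entry_def)
  show "inj (sel (K_set CARD('r) \<tau>) :: 'r \<Rightarrow> 'm::{finite,linorder})"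
    using inj_sel[OF sub] .
  have "pos p \<in> K_set CARD('r) \<tau> \<longleftrightarrow> p \<noteq> nth_of UNIV \<tau>" for p :: "'m::{finite,linorder}"
    using pos_in[of p] assms tau nth_of_pos[of p] by (auto simp: K_set_def)
  then show "range (sel (K_set CARD('r) \<tau>) :: 'r \<Rightarrow> 'm::{finite,linorder}) = - {nth_of UNIV \<tau>}"
    unfolding range_sel[OF sub] by blast
qed

section \<open>Series determined by the recurrence\<close>

lemma hankel_nth: "hankel S $ i $ j = S $ nth_of UNIV (pos i + pos j - 1)"
  by (simp add: hankel_def entry_def)

lemma mem_governed_series:
  "S \<in> governed_series TYPE('k::{finite,linorder}) (a :: real^'m::{finite,linorder}) \<longleftrightarrow>
     (\<forall>j::'k. (\<Sum>i\<in>UNIV. a $ i * S $ nth_of UNIV (pos i + pos j - 1)) = 0)"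
  by (simp add: governed_series_def vec_eq_iff vector_matrix_mult_def hankel_nth)

lemma subspace_governed_series: "subspace (governed_series TYPE('k::{finite,linorder}) a)"
  unfolding subspace_def mem_governed_series
  by (auto simp: mem_governed_series distrib_left sum.distrib mult.left_commute simp flip: sum_distrib_left)

text \<open>
  Rows numbered in \<open>C\<close> select coordinates, the others state the recurrence. With
  \<open>C = I_set N r \<tau>\<close> the matrix is square and pins down the governed series with given \<open>C\<close>-coordinates.
\<close>
definition gov_matrix ::
    "nat set \<Rightarrow> nat \<Rightarrow> real^'m::{finite,linorder} \<Rightarrow> real^'n::{finite,linorder}^'n::{finite,linorder}" where
  "gov_matrix C \<tau> a = (\<chi> p q. if pos p \<in> C then (if q = p then 1 else 0)
     else \<Sum>i\<in>UNIV. a $ i * (if q = nth_of UNIV (pos i + pos p - \<tau>) then 1 else 0))"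

text \<open>The right-hand side for \<open>gov_matrix\<close>: prescribed values in the rows of
  \<open>C\<close>, zeros in the recurrence rows.\<close>

definition extend :: "nat set \<Rightarrow> real^'r::{finite,linorder} \<Rightarrow> real^'n::{finite,linorder}" where
  "extend C s = (\<chi> p. if pos p \<in> C then s $ inv (sel C) p else 0)"

lemma gov_matrix_mult:
  "(gov_matrix C \<tau> a *v S) $ p =
     (if pos p \<in> C then S $ p else \<Sum>i\<in>UNIV. a $ i * S $ nth_of UNIV (pos i + pos p - \<tau>))"
proof (cases "pos p \<in> C")
  case True
  then show ?thesis
    by (simp add: gov_matrix_def matrix_vector_mult_def if_distrib[of "\<lambda>x. x * _"] cong: if_cong)
next
  case False
  have "(\<Sum>q\<in>UNIV. (\<Sum>i\<in>UNIV. a $ i * (if q = nth_of UNIV (pos i + pos p - \<tau>) then 1 else 0)) * S $ q)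
      = (\<Sum>i\<in>UNIV. \<Sum>q\<in>UNIV. a $ i * (if q = nth_of UNIV (pos i + pos p - \<tau>) then 1 else 0) * S $ q)"
    unfolding sum_distrib_right by (rule sum.swap)
  also have "\<dots> = (\<Sum>i\<in>UNIV. a $ i * S $ nth_of UNIV (pos i + pos p - \<tau>))"
    by (simp add: mult.assoc if_distrib[of "\<lambda>x. x * _"] flip: sum_distrib_left cong: if_cong)
  finally show ?thesis using False by (simp add: gov_matrix_def matrix_vector_mult_def)
qed

text \<open>The \<open>j\<close>-th recurrence equation is stored in row
  \<open>j + \<tau> - 1\<close>, the place of its \<open>\<tau>\<close>-th term. For
  \<open>j\<close> from 1 to \<open>N - r\<close> these rows fill exactly the block missing from
  \<open>I(\<tau>)\<close>, so no equation is lost or repeated.\<close>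

lemma gov_matrix_solution_iff:
  fixes a :: "real^'m::{finite,linorder}" and S :: "real^'n::{finite,linorder}"
    and s :: "real^'r::{finite,linorder}"
  assumes card: "CARD('k::{finite,linorder}) = CARD('n) - CARD('r)" "2 * CARD('r) < CARD('n)"
    and tau: "\<tau> \<in> {1..CARD('r) + 1}"
  defines "C \<equiv> I_set CARD('n) CARD('r) \<tau>"
  shows "gov_matrix C \<tau> a *v S = extend C s \<longleftrightarrow>
    S \<in> governed_series TYPE('k) a \<and> subvec C S = s"
proof -
  have C: "C \<subseteq> {1..CARD('n)}" "card C = CARD('r)"
    unfolding C_def by (rule I_set_sub) (rule card_I_set[OF card(2) tau])
  note sel = inj_sel[OF C] range_sel[OF C]
  have A: "(\<forall>p::'n. pos p \<in> C \<longrightarrow> S $ p = s $ inv (sel C) p) \<longleftrightarrow> (\<forall>k. S $ sel C k = s $ k)"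
    (is "?A \<longleftrightarrow> _")
  proof
    assume ?A
    show "\<forall>k. S $ sel C k = s $ k"
    proof
      fix k :: 'r
      have "pos (sel C k :: 'n) \<in> C" using sel(2) by blast
      with \<open>?A\<close> show "S $ sel C k = s $ k" by (simp add: inv_f_f[OF sel(1)])
    qed
  next
    assume R: "\<forall>k. S $ sel C k = s $ k"
    show ?A
    proof (intro allI impI)
      fix p :: 'n assume "pos p \<in> C"
      then obtain k :: 'r where "p = sel C k" using sel(2) by blast
      with R show "S $ p = s $ inv (sel C) p" by (simp add: inv_f_f[OF sel(1)])
    qed
  qed
  have B: "(\<forall>p::'n. pos p \<notin> C \<longrightarrow> (\<Sum>i\<in>UNIV. a $ i * S $ nth_of UNIV (pos i + pos p - \<tau>)) = 0)
      \<longleftrightarrow> S \<in> governed_series TYPE('k) a" (is "?B \<longleftrightarrow> _")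
    unfolding mem_governed_series
  proof
    assume ?B
    show "\<forall>j::'k. (\<Sum>i\<in>UNIV. a $ i * S $ nth_of UNIV (pos i + pos j - 1)) = 0"
    proof
      fix j :: 'k
      \<comment> \<open>The row that holds equation \<open>j\<close>; the subtractions are exact
        because positions and \<open>\<tau>\<close> are at least 1.\<close>
      let ?p = "nth_of UNIV (pos j + \<tau> - 1) :: 'n"
      have p: "pos ?p = pos j + \<tau> - 1"
        by (rule pos_nth_of) (use pos_in[of j] card tau in auto)
      then have "pos ?p \<notin> C" using pos_in[of j] card tau by (auto simp: C_def I_set_def)
      moreover have "pos i + pos ?p - \<tau> = pos i + pos j - 1" for i :: 'm
        using p pos_in[of j] tau by simp
      ultimately show "(\<Sum>i\<in>UNIV. a $ i * S $ nth_of UNIV (pos i + pos j - 1)) = 0"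
        using \<open>?B\<close>[rule_format, of ?p] by simp
    qed
  next
    assume R: "\<forall>j::'k. (\<Sum>i\<in>UNIV. a $ i * S $ nth_of UNIV (pos i + pos j - 1)) = 0"
    show ?B
    proof (intro allI impI)
      fix p :: 'n assume "pos p \<notin> C"
      then have p: "pos p \<in> {\<tau>..CARD('n) - CARD('r) - 1 + \<tau>}"
        using pos_in[of p] by (simp add: C_def I_set_def)
      let ?j = "nth_of UNIV (pos p + 1 - \<tau>) :: 'k"
      have "pos ?j = pos p + 1 - \<tau>"
        by (rule pos_nth_of) (use p card in auto)
      then have "pos i + pos ?j - 1 = pos i + pos p - \<tau>" for i :: 'm
        using p by simp
      then show "(\<Sum>i\<in>UNIV. a $ i * S $ nth_of UNIV (pos i + pos p - \<tau>)) = 0"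
        using R[rule_format, of ?j] by simp
    qed
  qed
  have "(gov_matrix C \<tau> a *v S) $ p = extend C s $ p \<longleftrightarrow>
      (pos p \<in> C \<longrightarrow> S $ p = s $ inv (sel C) p) \<and>
      (pos p \<notin> C \<longrightarrow> (\<Sum>i\<in>UNIV. a $ i * S $ nth_of UNIV (pos i + pos p - \<tau>)) = 0)" for p
    unfolding gov_matrix_mult by (simp add: extend_def)
  then have "gov_matrix C \<tau> a *v S = extend C s \<longleftrightarrow> ?A \<and> ?B"
    unfolding vec_eq_iff by (simp only: all_conj_distrib)
  also have "\<dots> \<longleftrightarrow> (\<forall>k. S $ sel C k = s $ k) \<and> S \<in> governed_series TYPE('k) a"
    unfolding A B ..
  also have "(\<forall>k. S $ sel C k = s $ k) \<longleftrightarrow> subvec C S = s"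
    by (simp add: vec_eq_iff subvec_nth)
  finally show ?thesis by (simp only: conj_commute)
qed

lemma subrows_mult: "subrows C B *v w = subvec C (B *v w)"
  by (simp add: vec_eq_iff subvec_nth subrows_nth matrix_vector_mult_def)

section \<open>The recurrence determined by the series\<close>

text \<open>
  For a governed series, row \<open>\<tau>\<close> of the trajectory matrix is a linear combination of the others, with
  the recurrence as coefficients; \<open>regressors\<close> consists of these other rows. The coefficients are
  recovered from the normal equations.
\<close>
definition regressors :: "'k::{finite,linorder} itself \<Rightarrow> 'm::{finite,linorder} itself \<Rightarrow> nat
    \<Rightarrow> real^'n::{finite,linorder} \<Rightarrow> real^'k::{finite,linorder}^'r::{finite,linorder}" where
  "regressors _ _ \<tau> S = subrows (K_set CARD('r) \<tau>) (hankel S :: real^'k::{finite,linorder}^'m::{finite,linorder})"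

definition gram :: "'k::{finite,linorder} itself \<Rightarrow> 'm::{finite,linorder} itself \<Rightarrow> nat
    \<Rightarrow> real^'n::{finite,linorder} \<Rightarrow> real^'r::{finite,linorder}^'r::{finite,linorder}" where
  "gram k m \<tau> S = regressors k m \<tau> S ** transpose (regressors k m \<tau> S)"

definition coeffs :: "'k::{finite,linorder} itself \<Rightarrow> 'm::{finite,linorder} itself \<Rightarrow> nat
    \<Rightarrow> real^'n::{finite,linorder} \<Rightarrow> real^'r::{finite,linorder}" where
  "coeffs k m \<tau> S = lin_solve (gram k m \<tau> S)
     (regressors k m \<tau> S *v ((hankel S :: real^'k::{finite,linorder}^'m::{finite,linorder}) $ nth_of UNIV \<tau>))"

lemma gram_left_mult: "gram k m \<tau> S *v a = regressors k m \<tau> S *v (a v* regressors k m \<tau> S)"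
  by (simp add: gram_def flip: matrix_vector_mul_assoc)

text \<open>Pairing \<open>R R^T a = 0\<close> with \<open>a\<close> gives a vanishing squared norm
  of \<open>a v* R\<close>; hence the Gram matrix is nonsingular exactly when the regressors are
  linearly independent.\<close>

lemma gram_nonzero_iff: "det (gram k m \<tau> S :: real^'r::{finite,linorder}^'r::{finite,linorder}) \<noteq> 0 \<longleftrightarrow>
    (\<forall>a :: real^'r::{finite,linorder}. a v* regressors k m \<tau> S = 0 \<longrightarrow> a = 0)"
  (is "_ \<longleftrightarrow> ?R")
proof -
  have "gram k m \<tau> S *v a = 0 \<longleftrightarrow> a v* regressors k m \<tau> S = 0" for a :: "real^'r::{finite,linorder}"
  proof
    assume "gram k m \<tau> S *v a = 0"
    then have "a \<bullet> (regressors k m \<tau> S *v (a v* regressors k m \<tau> S)) = 0"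
      by (simp add: gram_left_mult)
    then show "a v* regressors k m \<tau> S = 0"
      by (simp add: dot_lmul_matrix[symmetric])
  qed (simp add: gram_left_mult)
  then show ?thesis by (simp add: det_nonzero_iff_kernel)
qed

lemma regressors_nth:
  "regressors TYPE('k::{finite,linorder}) TYPE('m::{finite,linorder}) \<tau> S $ (l :: 'r::{finite,linorder}) =
    (hankel S :: real^'k::{finite,linorder}^'m::{finite,linorder}) $ sel (K_set CARD('r) \<tau>) l"
  by (simp add: regressors_def subrows_nth)

text \<open>Splits off row \<open>\<tau>\<close>, since \<open>sel\<close> enumerates all the other
  rows once each.\<close>

lemma hankel_left_mult:
  fixes b :: "real^'m::{finite,linorder}" and S :: "real^'n::{finite,linorder}"
  assumes "CARD('m::{finite,linorder}) = CARD('r::{finite,linorder}) + 1" "\<tau> \<in> {1..CARD('r::{finite,linorder}) + 1}"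
  shows "b v* (hankel S :: real^'k::{finite,linorder}^'m::{finite,linorder}) =
    b $ nth_of UNIV \<tau> *\<^sub>R ((hankel S :: real^'k::{finite,linorder}^'m::{finite,linorder}) $ nth_of UNIV \<tau>) +
    (subvec (K_set CARD('r::{finite,linorder}) \<tau>) b :: real^'r::{finite,linorder}) v* regressors TYPE('k::{finite,linorder}) TYPE('m::{finite,linorder}) \<tau> S"
proof -
  let ?t = "nth_of UNIV \<tau> :: 'm" and ?q = "sel (K_set CARD('r) \<tau>) :: 'r \<Rightarrow> 'm"
  have "(\<Sum>i\<in>UNIV. f i) = f ?t + (\<Sum>l\<in>UNIV. f (?q l))" for f :: "'m \<Rightarrow> real"
  proof -
    have "(\<Sum>i\<in>UNIV. f i) = f ?t + (\<Sum>i\<in>- {?t}. f i)"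
      by (simp add: sum.remove Compl_eq_Diff_UNIV)
    also have "- {?t} = ?q ` UNIV" using range_sel_K[OF assms] ..
    also have "(\<Sum>i\<in>?q ` UNIV. f i) = (\<Sum>l\<in>UNIV. f (?q l))"
      using inj_sel_K[OF assms] by (simp add: sum.reindex)
    finally show ?thesis .
  qed
  then show ?thesis
    by (simp add: vec_eq_iff vector_matrix_mult_def subvec_nth regressors_nth)
qed

lemma subvec_insert_minus_one:
  fixes a :: "real^'r::{finite,linorder}"
  assumes "CARD('m::{finite,linorder}) = CARD('r) + 1" "\<tau> \<in> {1..CARD('r) + 1}"
  shows "subvec (K_set CARD('r) \<tau>) (insert_minus_one \<tau> a :: real^'m::{finite,linorder}) = a"
  using insert_minus_one_sel[OF assms] by (simp add: vec_eq_iff subvec_nth)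

lemma vec_eqI_sel_K:
  fixes b c :: "real^'m::{finite,linorder}"
  assumes "CARD('m::{finite,linorder}) = CARD('r::{finite,linorder}) + 1" "\<tau> \<in> {1..CARD('r::{finite,linorder}) + 1}"
    and "b $ nth_of UNIV \<tau> = c $ nth_of UNIV \<tau>"
    and "(subvec (K_set CARD('r::{finite,linorder}) \<tau>) b :: real^'r::{finite,linorder}) = subvec (K_set CARD('r::{finite,linorder}) \<tau>) c"
  shows "b = c"
proof -
  have "b $ i = c $ i" for i
  proof (cases "i = nth_of UNIV \<tau>")
    case False
    then obtain l :: 'r where "i = sel (K_set CARD('r) \<tau>) l"
      using range_sel_K[OF assms(1,2)] by blast
    then show ?thesis using assms(4) by (simp add: vec_eq_iff subvec_nth)
  qed (use assms in simp)
  then show ?thesis by (simp add: vec_eq_iff)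
qed

context
  fixes S :: "real^'n::{finite,linorder}" and \<tau> :: nat
    and k :: "'k::{finite,linorder} itself" and m :: "'m::{finite,linorder} itself"
    and r :: "'r::{finite,linorder} itself"
  assumes card: "CARD('m) = CARD('r) + 1" and tau: "\<tau> \<in> {1..CARD('r) + 1}"
begin

text \<open>With coefficient -1 at \<open>\<tau>\<close>, the recurrence is solved for row
  \<open>\<tau>\<close> of the trajectory matrix.\<close>

lemma governed_insert_iff:
  fixes a :: "real^'r::{finite,linorder}"
  shows "S \<in> governed_series TYPE('k) (insert_minus_one \<tau> a :: real^'m::{finite,linorder}) \<longleftrightarrow>
    a v* regressors TYPE('k) TYPE('m) \<tau> S = (hankel S :: real^'k::{finite,linorder}^'m::{finite,linorder}) $ nth_of UNIV \<tau>"
  by (simp add: governed_series_def hankel_left_mult[OF card tau] insert_minus_one_at[OF card tau]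
      subvec_insert_minus_one[OF card tau])

text \<open>The regression is exact here: multiplying it by the regressors gives the normal
  equations, whose only solution is then \<open>a\<close>.\<close>

lemma coeffs_unique:
  fixes a :: "real^'r::{finite,linorder}"
  assumes "det (gram TYPE('k) TYPE('m) \<tau> S :: real^'r::{finite,linorder}^'r::{finite,linorder}) \<noteq> 0"
    and "S \<in> governed_series TYPE('k) (insert_minus_one \<tau> a :: real^'m::{finite,linorder})"
  shows "coeffs TYPE('k) TYPE('m) \<tau> S = a"
proof -
  have "gram TYPE('k) TYPE('m) \<tau> S *v a =
      regressors TYPE('k) TYPE('m) \<tau> S *v ((hankel S :: real^'k::{finite,linorder}^'m::{finite,linorder}) $ nth_of UNIV \<tau>)"
    using assms(2) by (simp add: governed_insert_iff gram_left_mult)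
  then show ?thesis
    unfolding coeffs_def lin_solve_iff[OF assms(1)] by simp
qed

text \<open>A nonzero left kernel vector makes the \<open>r + 1\<close> rows dependent.\<close>

lemma rank_hankel_le:
  assumes "S \<in> governed_series TYPE('k) (a :: real^'m::{finite,linorder})" "a \<noteq> 0"
  shows "rank (hankel S :: real^'k::{finite,linorder}^'m::{finite,linorder}) \<le> CARD('r)"
proof -
  have "rank (transpose (hankel S :: real^'k::{finite,linorder}^'m::{finite,linorder})) \<noteq> CARD('m)"
    using assms by (subst matrix_nonfull_linear_equations_eq[symmetric]) (auto simp: governed_series_def)
  then show ?thesis
    using rank_bound[of "hankel S :: real^'k::{finite,linorder}^'m::{finite,linorder}"] card by (simp add: rank_transpose)
qed

text \<open>The regressors are \<open>r\<close> independent rows of the trajectory matrix.\<close>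

lemma rank_hankel_ge:
  assumes "det (gram TYPE('k) TYPE('m) \<tau> S :: real^'r::{finite,linorder}^'r::{finite,linorder}) \<noteq> 0"
  shows "CARD('r) \<le> rank (hankel S :: real^'k::{finite,linorder}^'m::{finite,linorder})"
proof -
  let ?R = "regressors TYPE('k) TYPE('m) \<tau> S :: real^'k::{finite,linorder}^'r::{finite,linorder}"
  have "CARD('r) = rank (transpose ?R)"
    using assms matrix_nonfull_linear_equations_eq[of "transpose ?R"] unfolding gram_nonzero_iff by auto
  also have "\<dots> = dim (rows ?R)" by (rule trans[OF rank_transpose row_rank_def])
  also have "\<dots> \<le> dim (rows (hankel S :: real^'k::{finite,linorder}^'m::{finite,linorder}))"
    by (rule dim_subset) (auto simp: rows_eq_range regressors_nth)
  finally show ?thesis by (simp add: row_rank_def)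
qed

text \<open>Rank \<open>r\<close> among \<open>r + 1\<close> rows yields some left kernel vector.
  Scaling its entry at \<open>\<tau>\<close> to -1 gives a recurrence of the required form, and by
  uniqueness its coefficients are \<open>coeffs\<close>.\<close>

lemma governed_coeffs:
  assumes gram: "det (gram TYPE('k) TYPE('m) \<tau> S :: real^'r::{finite,linorder}^'r::{finite,linorder}) \<noteq> 0"
    and rank: "S \<in> rank_series TYPE('k) TYPE('m) CARD('r)"
  shows "S \<in> governed_series TYPE('k) (insert_minus_one \<tau> (coeffs TYPE('k) TYPE('m) \<tau> S :: real^'r::{finite,linorder}) :: real^'m::{finite,linorder})"
proof -
  let ?R = "regressors TYPE('k) TYPE('m) \<tau> S :: real^'k::{finite,linorder}^'r::{finite,linorder}"
  let ?t = "nth_of UNIV \<tau> :: 'm"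
  have "rank (transpose (hankel S :: real^'k::{finite,linorder}^'m::{finite,linorder})) \<noteq> CARD('m)"
    using rank card by (simp add: rank_series_def rank_transpose)
  then obtain b where b: "b \<noteq> 0" "b v* (hankel S :: real^'k::{finite,linorder}^'m::{finite,linorder}) = 0"
    by (subst (asm) matrix_nonfull_linear_equations_eq[symmetric]) auto
  define c where "c = (subvec (K_set CARD('r) \<tau>) b :: real^'r::{finite,linorder})"
  have eq: "b $ ?t *\<^sub>R ((hankel S :: real^'k::{finite,linorder}^'m::{finite,linorder}) $ ?t) + c v* ?R = 0"
    using b(2) unfolding c_def hankel_left_mult[OF card tau] .
  \<comment> \<open>Otherwise \<open>b\<close> would be a dependence among the regressors
    alone.\<close>
  have bt: "b $ ?t \<noteq> 0"
  proof
    assume 0: "b $ ?t = 0"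
    then have "c = 0" using eq gram unfolding gram_nonzero_iff by simp
    then have "b = 0"
      using 0 by (intro vec_eqI_sel_K[OF card tau]) (auto simp: c_def vec_eq_iff subvec_nth)
    with b(1) show False by simp
  qed
  define a where "a = (- inverse (b $ ?t)) *\<^sub>R c"
  have "a v* ?R = (- inverse (b $ ?t)) *\<^sub>R (c v* ?R)"
    by (simp add: a_def vec_eq_iff vector_matrix_mult_def sum_distrib_left mult.assoc sum_negf)
  also have "c v* ?R = - (b $ ?t *\<^sub>R ((hankel S :: real^'k::{finite,linorder}^'m::{finite,linorder}) $ ?t))"
    using eq by (simp add: add_eq_0_iff)
  finally have "a v* ?R = (hankel S :: real^'k::{finite,linorder}^'m::{finite,linorder}) $ ?t" using bt by simp
  then have "S \<in> governed_series TYPE('k) (insert_minus_one \<tau> a :: real^'m::{finite,linorder})"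
    by (simp add: governed_insert_iff)
  with coeffs_unique[OF gram this] show ?thesis by simp
qed

text \<open>The recurrence makes row \<open>\<tau>\<close> redundant, so the \<open>r\<close>
  regressors span a row space of dimension \<open>r\<close> and must be independent.\<close>

lemma gram_nonzero:
  assumes a: "S \<in> governed_series TYPE('k) (insert_minus_one \<tau> (a :: real^'r::{finite,linorder}) :: real^'m::{finite,linorder})"
    and rank: "S \<in> rank_series TYPE('k) TYPE('m) CARD('r)"
  shows "det (gram TYPE('k) TYPE('m) \<tau> S :: real^'r::{finite,linorder}^'r::{finite,linorder}) \<noteq> 0"
proof -
  let ?T = "hankel S :: real^'k::{finite,linorder}^'m::{finite,linorder}" and ?R = "regressors TYPE('k) TYPE('m) \<tau> S :: real^'k::{finite,linorder}^'r::{finite,linorder}"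
  have R: "?R $ l \<in> span (rows ?R)" for l
    by (rule span_base) (simp add: rows_eq_range)
  have "?T $ i \<in> span (rows ?R)" for i
  proof (cases "i = nth_of UNIV \<tau>")
    case True
    have "?T $ i = a v* ?R"
      using a unfolding governed_insert_iff True ..
    also have "\<dots> = (\<Sum>l\<in>UNIV. a $ l *\<^sub>R (?R $ l))"
      by (simp add: vec_eq_iff vector_matrix_mult_def)
    also have "\<dots> \<in> span (rows ?R)"
      by (intro span_sum span_scale R)
    finally show ?thesis .
  next
    case False
    then obtain l where "i = sel (K_set CARD('r) \<tau>) (l :: 'r)"
      using range_sel_K[OF card tau] by blast
    then show ?thesis using R[of l] by (simp add: regressors_nth)
  qed
  then have "rows ?T \<subseteq> span (rows ?R)" by (auto simp: rows_eq_range)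
  then have "dim (rows ?T) \<le> dim (span (rows ?R))" by (rule dim_subset)
  then have "rank ?T \<le> rank ?R" unfolding row_rank_def dim_span .
  then have "rank (transpose ?R) = CARD('r)"
    using rank rank_bound[of ?R] by (simp add: rank_series_def rank_transpose)
  then show ?thesis
    using matrix_nonfull_linear_equations_eq[of "transpose ?R"] unfolding gram_nonzero_iff by auto
qed

end

section \<open>The local parameterization\<close>

lemma rational_insert_minus_one:
  assumes "\<And>k. rational_on U (\<lambda>x. a x $ k)"
  shows "rational_on U (\<lambda>x. (insert_minus_one \<tau> (a x) :: real^'m::{finite,linorder}) $ i)"
  using assms
  by (cases "pos i < \<tau>"; cases "pos i = \<tau>") (simp_all add: insert_minus_one_def entry_def rational_const)

lemma rational_gov_matrix:
  assumes "\<And>k. rational_on U (\<lambda>x. a x $ k)"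
  shows "rational_on U (\<lambda>x. gov_matrix C \<tau> (a x) $ p $ q)"
  using assms
  by (cases "pos p \<in> C") (simp_all add: gov_matrix_def rational_const rational_sum rational_mult)

lemma rational_extend:
  assumes "\<And>k. rational_on U (\<lambda>x. s x $ k)"
  shows "rational_on U (\<lambda>x. extend C (s x) $ p)"
  using assms by (cases "pos p \<in> C") (simp_all add: extend_def rational_const)

lemma rational_hankel:
  assumes "\<And>k. rational_on U (\<lambda>x. S x $ k)"
  shows "rational_on U (\<lambda>x. hankel (S x) $ i $ j)"
  using assms by (simp add: hankel_nth)

lemma rational_regressors:
  assumes "\<And>k. rational_on U (\<lambda>x. S x $ k)"
  shows "rational_on U (\<lambda>x. regressors TYPE('k::{finite,linorder}) TYPE('m::{finite,linorder}) \<tau> (S x) $ i $ j)"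
  using assms by (simp add: regressors_nth rational_hankel)

lemma rational_gram:
  assumes "\<And>k. rational_on U (\<lambda>x. S x $ k)"
  shows "rational_on U (\<lambda>x. gram TYPE('k::{finite,linorder}) TYPE('m::{finite,linorder}) \<tau> (S x) $ i $ j)"
  using assms
  by (simp add: gram_def matrix_matrix_mult_def transpose_def rational_sum rational_mult rational_regressors)

lemma rational_coeffs:
  fixes S :: "'a::euclidean_space \<Rightarrow> real^'n::{finite,linorder}"
  assumes "\<And>k. rational_on U (\<lambda>x. S x $ k)"
    and "\<And>x. x \<in> U \<Longrightarrow> det (gram TYPE('k::{finite,linorder}) TYPE('m::{finite,linorder}) \<tau> (S x)
      :: real^'r::{finite,linorder}^'r::{finite,linorder}) \<noteq> 0"
  shows "rational_on U (\<lambda>x. (coeffs TYPE('k) TYPE('m) \<tau> (S x) :: real^'r::{finite,linorder}) $ i)"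
  unfolding coeffs_def
proof (rule rational_lin_solve)
  show "rational_on U (\<lambda>x. (regressors TYPE('k) TYPE('m) \<tau> (S x) *v
      ((hankel (S x) :: real^'k::{finite,linorder}^'m::{finite,linorder}) $ nth_of UNIV \<tau>)
      :: real^'r::{finite,linorder}) $ i)" for i
    using assms(1)
    by (simp add: matrix_vector_mult_def rational_sum rational_mult rational_regressors rational_hankel)
qed (use assms in \<open>simp_all add: rational_gram\<close>)

lemma rational_fst_nth: "rational_on U (\<lambda>u. fst u $ k)"
  for U :: "((real^'n) \<times> 'b::euclidean_space) set"
  by (intro rational_linear bounded_linear_compose[OF bounded_linear_vec_nth] bounded_linear_fst)

lemma rational_snd_nth: "rational_on U (\<lambda>u. snd u $ k)"
  for U :: "('b::euclidean_space \<times> (real^'n)) set"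
  by (intro rational_linear bounded_linear_compose[OF bounded_linear_vec_nth] bounded_linear_snd)

lemma rational_nth: "rational_on U (\<lambda>x. x $ k)" for U :: "(real^'n) set"
  by (intro rational_linear bounded_linear_vec_nth)

text \<open>
  Nonsingularity of \<open>\<langle>z\<^sub>i, y\<^sub>j\<rangle>\<close> with \<open>y\<^sub>j\<close> in the governed space prevents combinations of the \<open>z\<^sub>i\<close> from
  being orthogonal to that space, so the projected basis is still parameterized by its \<open>C\<close>-coordinates.
\<close>
lemma param_eq:
  fixes Z0 :: "real^'r::{finite,linorder}^'n::{finite,linorder}"
    and a s :: "real^'r::{finite,linorder}" and \<tau> :: nat
  defines "C \<equiv> I_set CARD('n) CARD('r) \<tau>"
    and "V \<equiv> governed_series TYPE('k::{finite,linorder})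
      (insert_minus_one \<tau> a :: real^'m::{finite,linorder})"
  assumes uniq: "\<And>y. y \<in> V \<Longrightarrow> subvec C y = (0 :: real^'r::{finite,linorder}) \<Longrightarrow> y = 0"
    and y: "\<And>j :: 'r. y j \<in> V"
    and det: "det (\<chi> i j. column i Z0 \<bullet> y j) \<noteq> 0"
  shows "param TYPE('k) TYPE('m) \<tau> Z0 (s, a) \<in> V"
    and "subvec C (param TYPE('k) TYPE('m) \<tau> Z0 (s, a)) = s"
proof -
  let ?Z = "matrix (orth_proj V) ** Z0"
  let ?ZC = "subrows C ?Z :: real^'r::{finite,linorder}^'r::{finite,linorder}"
  have sub: "subspace V" unfolding V_def by (rule subspace_governed_series)
  have Z: "?Z *v w = orth_proj V (Z0 *v w)" for w
    by (simp add: matrix_works linear_orth_proj[OF sub] flip: matrix_vector_mul_assoc)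
  have ZV: "?Z *v w \<in> V" for w
    unfolding Z using orth_proj_works[OF sub] by blast
  have "w = 0" if "?ZC *v w = 0" for w
  proof -
    \<comment> \<open>The projected series has zero \<open>C\<close>-coordinates, so
      \<open>uniq\<close> makes it vanish; \<open>Z0 *v w\<close> is then orthogonal to all of
      \<open>V\<close>, in particular to each \<open>y j\<close>.\<close>
    have "orth_proj V (Z0 *v w) = 0"
      using uniq[OF ZV, of w] that by (simp add: subrows_mult Z)
    then have orth: "(Z0 *v w) \<bullet> y j = 0" for j
      using orth_proj_works[OF sub, of "Z0 *v w"] y[of j] by (simp add: orthogonal_def)
    have "w v* (\<chi> i j. column i Z0 \<bullet> y j) = (\<chi> j. (Z0 *v w) \<bullet> y j)"
      by (simp add: vec_eq_iff vector_matrix_mult_def matrix_mult_sum inner_sum_left scalar_mult_eq_scaleR)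
    then have "w v* (\<chi> i j. column i Z0 \<bullet> y j) = 0" by (simp add: orth vec_eq_iff)
    with det show "w = 0" unfolding det_nonzero_iff_left_kernel by blast
  qed
  then have "invertible ?ZC"
    unfolding invertible_det_nz det_nonzero_iff_kernel by blast
  then have inv: "?ZC ** matrix_inv ?ZC = mat 1"
    unfolding invertible_def matrix_inv_def by (rule someI2_ex) simp
  have param: "param TYPE('k) TYPE('m) \<tau> Z0 (s, a) = ?Z *v (matrix_inv ?ZC *v s)"
    by (simp add: param_def V_def C_def Let_def)
  show "param TYPE('k) TYPE('m) \<tau> Z0 (s, a) \<in> V" unfolding param by (rule ZV)
  show "subvec C (param TYPE('k) TYPE('m) \<tau> Z0 (s, a)) = s"
    unfolding param subrows_mult[symmetric] by (simp add: matrix_vector_mul_assoc inv)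
qed

text \<open>Invertibility of the \<open>I(\<tau>)\<close>-rows of \<open>Z0\<close> expresses that
  the explicit formula makes sense at the base point. It does not follow from the entry -1 at
  \<open>\<tau>\<close>: for \<open>N = 7\<close>, \<open>r = 2\<close>, \<open>\<tau> = 2\<close>
  and recurrence \<open>(1,-1,1)\<close>, the series \<open>(0,1,1,0,-1,-1,0)\<close> is governed
  and vanishes on \<open>I(\<tau>) = {1,7}\<close>.\<close>

theorem theorem2p2:
  fixes N r \<tau> :: nat
    and a0 :: "real^'m::{finite,linorder}"
    and S0 :: "real^'n::{finite,linorder}"
    and Z0 :: "real^'r::{finite,linorder}^'n::{finite,linorder}"
  assumes "CARD('n) = N" and "CARD('r) = r" and "CARD('m) = r + 1"
    and "CARD('k::{finite,linorder}) = N - r"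
    and "1 \<le> r" and "2 * r < N"
    and "\<tau> \<in> {1..r + 1}"
    and "entry a0 \<tau> = -1"
    and "S0 \<in> rank_series TYPE('k) TYPE('m) r"
    and "S0 \<in> governed_series TYPE('k) a0"
    and "columns_basis Z0 (governed_series TYPE('k) a0)"
    and "invertible (subrows (I_set N r \<tau>) Z0 :: real^'r::{finite,linorder}^'r::{finite,linorder})"
  shows "\<exists>U V. open U \<and> (subvec (I_set N r \<tau>) S0, subvec (K_set r \<tau>) a0) \<in> U \<and>
      open V \<and> S0 \<in> V \<and>
      (\<forall>s a S. (s, a) \<in> U \<longrightarrow>
        (S = param TYPE('k) TYPE('m) \<tau> Z0 (s, a) \<longleftrightarrow>
           S \<in> rank_series TYPE('k) TYPE('m) r \<and>
           S \<in> governed_series TYPE('k) (insert_minus_one \<tau> a :: real^'m::{finite,linorder}) \<and>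
           subvec (I_set N r \<tau>) S = s)) \<and>
      diffeomorphism_betw (param TYPE('k) TYPE('m) \<tau> Z0) U (V \<inter> rank_series TYPE('k) TYPE('m) r)"
proof -
  note N = assms(1)[symmetric] and r = assms(2)[symmetric]
  have tau: "\<tau> \<in> {1..CARD('r) + 1}" and cm: "CARD('m) = CARD('r) + 1"
    and ck: "CARD('k) = CARD('n) - CARD('r)" and cn: "2 * CARD('r) < CARD('n)"
    unfolding assms(1,2) by fact+
  define C where "C = I_set N r \<tau>"
  define K where "K = K_set r \<tau>"
  define D where "D = (rank_series TYPE('k) TYPE('m) r :: (real^'n::{finite,linorder}) set)"
  define gov where "gov = (\<lambda>a :: real^'r::{finite,linorder}.
    (governed_series TYPE('k) (insert_minus_one \<tau> a :: real^'m::{finite,linorder})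
      :: (real^'n::{finite,linorder}) set))"
  define M where "M = (\<lambda>a :: real^'r::{finite,linorder}.
    gov_matrix C \<tau> (insert_minus_one \<tau> a :: real^'m::{finite,linorder})
      :: real^'n::{finite,linorder}^'n::{finite,linorder})"
  \<comment> \<open>Rational stand-in for the parameterization, to be identified with it on
    \<open>U2\<close>.\<close>
  define \<phi> where "\<phi> = (\<lambda>u :: (real^'r::{finite,linorder}) \<times> (real^'r::{finite,linorder}).
    lin_solve (M (snd u)) (extend C (fst u)))"
  \<comment> \<open>The second factor in each product is the series governed by \<open>a\<close>
    that shares its \<open>C\<close>-coordinates with column \<open>j\<close> of \<open>Z0\<close>.
    These series act as the \<open>y j\<close> of \<open>param_eq\<close>; at the base point they
    are the columns themselves, and \<open>G\<close> is their Gram matrix.\<close>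
  define G where "G = (\<lambda>a. (\<chi> i j. column i Z0 \<bullet> \<phi> (subvec C (column j Z0), a))
    :: real^'r::{finite,linorder}^'r::{finite,linorder})"
  define g where "g = (\<lambda>S :: real^'n::{finite,linorder}.
    det (gram TYPE('k) TYPE('m) \<tau> S :: real^'r::{finite,linorder}^'r::{finite,linorder}))"
  define \<psi> where "\<psi> = (\<lambda>S :: real^'n::{finite,linorder}.
    (subvec C S :: real^'r::{finite,linorder}, coeffs TYPE('k) TYPE('m) \<tau> S :: real^'r::{finite,linorder}))"
  \<comment> \<open>Successive restrictions: on \<open>U1\<close> the linear system is uniquely
    solvable, on \<open>U2\<close> the projection formula agrees with \<open>\<phi>\<close>, and on
    \<open>U\<close> the solution has independent regressors, hence rank \<open>r\<close>.\<close>
  define U1 where "U1 = {u \<in> UNIV :: ((real^'r::{finite,linorder}) \<times> (real^'r::{finite,linorder})) set. det (M (snd u)) \<noteq> 0}"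
  define U2 where "U2 = {u \<in> U1. det (G (snd u)) \<noteq> 0}"
  define U where "U = {u \<in> U2. g (\<phi> u) \<noteq> 0}"
  define W where "W = {S \<in> UNIV. g S \<noteq> 0}"
  \<comment> \<open>The preimage makes \<open>\<psi>\<close> map \<open>V\<close> into
    \<open>U\<close> by construction.\<close>
  define V where "V = W \<inter> \<psi> -` U"
  let ?p = "param TYPE('k) TYPE('m) \<tau> Z0"

  have gov_eq: "governed_series TYPE('k) (insert_minus_one \<tau> a :: real^'m::{finite,linorder}) = gov a" for a :: "real^'r::{finite,linorder}"
    by (simp add: gov_def)
  have sol: "M a *v S = extend C s \<longleftrightarrow> S \<in> gov a \<and> subvec C S = s"
    for a S and s :: "real^'r::{finite,linorder}"
    unfolding M_def C_def gov_def N r by (rule gov_matrix_solution_iff[OF ck cn tau])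
  have \<phi>_iff: "S = \<phi> (s, a) \<longleftrightarrow> S \<in> gov a \<and> subvec C S = s" if "det (M a) \<noteq> 0" for a s S
    using lin_solve_iff[OF that, of S "extend C s"] by (simp add: \<phi>_def sol)
  have zero: "0 \<in> gov a" for a
    unfolding gov_def by (rule subspace_0[OF subspace_governed_series])
  have subvec_0: "subvec C (0 :: real^'n::{finite,linorder}) = (0 :: real^'r::{finite,linorder})"
    by (simp add: vec_eq_iff subvec_nth)
  have uniq0: "S = 0" if "det (M a) \<noteq> 0" "S \<in> gov a" "subvec C S = (0 :: real^'r::{finite,linorder})" for S a
    using \<phi>_iff[OF that(1), of S 0] \<phi>_iff[OF that(1), of 0 0] that zero subvec_0 by simp

  \<comment> \<open>\<open>param_eq\<close> shows that the explicit formula solves the linear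
    system; uniqueness of the solution does the rest.\<close>
  have p_eq: "?p u = \<phi> u" if "u \<in> U2" for u
  proof -
    obtain s a where u: "u = (s, a)" by (cases u)
    have M: "det (M a) \<noteq> 0" and G: "det (G a) \<noteq> 0"
      using that by (auto simp: U1_def U2_def u)
    have y: "\<phi> (subvec C (column j Z0), a) \<in> gov a" for j
      using \<phi>_iff[OF M] by blast
    note * = param_eq[where 'k='k and 'm='m and ?Z0.0=Z0 and \<tau>=\<tau> and a=a and s=s, folded N r, folded C_def, unfolded gov_eq,
      OF uniq0[OF M] y G[unfolded G_def]]
    show ?thesis unfolding u \<phi>_iff[OF M] using * by blast
  qed

  have rM: "rational_on X (\<lambda>u. M (snd u) $ i $ j)" for X i j
    unfolding M_def by (intro rational_gov_matrix rational_insert_minus_one rational_snd_nth)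
  have U1: "open U1"
    unfolding U1_def by (intro open_rational_nonzero rational_det rM) simp
  have r\<phi>: "rational_on U1 (\<lambda>u. \<phi> u $ k)" for k
    unfolding \<phi>_def
    by (intro rational_lin_solve rM rational_extend rational_fst_nth) (simp add: U1_def)
  \<comment> \<open>Needed for \<open>G\<close>, which evaluates \<open>\<phi>\<close> at the fixed
    coordinates of a column of \<open>Z0\<close>.\<close>
  have r\<phi>_const: "rational_on U1 (\<lambda>u. \<phi> (c, snd u) $ k)" for k c
    unfolding \<phi>_def fst_conv snd_conv
    by (intro rational_lin_solve rM rational_extend rational_const) (simp add: U1_def)
  have U2: "open U2"
    unfolding U2_def G_def inner_vec_def inner_real_def
    by (intro open_rational_nonzero rational_det U1)
      (simp add: rational_sum rational_mult rational_const r\<phi>_const)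
  have r\<phi>2: "rational_on U2 (\<lambda>u. \<phi> u $ k)" for k
    by (rule rational_on_subset[OF r\<phi>]) (auto simp: U2_def)
  have U: "open U"
    unfolding U_def g_def by (intro open_rational_nonzero rational_det U2 rational_gram r\<phi>2)
  have sU: "U \<subseteq> U2" by (auto simp: U_def)
  have smooth_\<phi>: "smooth_on_open \<phi> U"
    by (intro smooth_on_open_rational U rational_vec_components rational_on_subset[OF r\<phi>2 sU])
  have W: "open W"
    unfolding W_def g_def by (intro open_rational_nonzero rational_det rational_gram rational_nth) simp
  have r\<psi>: "rational_on W (\<lambda>S. \<psi> S \<bullet> b)" if "b \<in> Basis" for b
    using that
  proof (rule rational_pair_components[rotated 2])
    show "rational_on W (\<lambda>S. fst (\<psi> S) $ k)" for k
      by (simp add: \<psi>_def subvec_nth rational_nth)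
    show "rational_on W (\<lambda>S. snd (\<psi> S) $ k)" for k
      unfolding \<psi>_def snd_conv by (rule rational_coeffs) (auto simp: W_def g_def rational_nth)
  qed
  have smooth_\<psi>: "smooth_on_open \<psi> W" by (intro smooth_on_open_rational W r\<psi>)
  have V: "open V"
    unfolding V_def by (intro continuous_open_preimage continuous_on_rational_components r\<psi> W U)

  \<comment> \<open>\<open>g S \<noteq> 0\<close> bounds the rank from below, and a nonzero
    governing vector bounds it from above.\<close>
  have rank_D: "S \<in> D" if "g S \<noteq> 0" "S \<in> gov a" for S a
  proof -
    have "(insert_minus_one \<tau> a :: real^'m::{finite,linorder}) \<noteq> 0"
      using insert_minus_one_at[OF cm tau, of a] by auto
    with rank_hankel_le[OF cm tau that(2)[unfolded gov_def]] rank_hankel_ge[OF cm tau that(1)[unfolded g_def]]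
    show ?thesis by (simp add: D_def rank_series_def r)
  qed
  have \<psi>_\<phi>: "\<psi> S = (s, a)" if "g S \<noteq> 0" "S \<in> gov a" "subvec C S = s" for S s a
    using coeffs_unique[OF cm tau that(1)[unfolded g_def] that(2)[unfolded gov_def]] that(3)
    by (simp add: \<psi>_def)
  have \<psi>_gov: "S \<in> gov (snd (\<psi> S))" if "g S \<noteq> 0" "S \<in> D" for S
    using governed_coeffs[OF cm tau that(1)[unfolded g_def] that(2)[unfolded D_def r]]
    by (simp add: \<psi>_def gov_def)

  have char: "S = ?p (s, a) \<longleftrightarrow> S \<in> D \<and> S \<in> gov a \<and> subvec C S = s" if "(s, a) \<in> U" for s a S
  proof -
    have "det (M a) \<noteq> 0" "g (\<phi> (s, a)) \<noteq> 0" and p: "?p (s, a) = \<phi> (s, a)"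
      using that sU p_eq by (auto simp: U_def U2_def U1_def)
    then show ?thesis using \<phi>_iff[of a S s] rank_D[of S a] by auto
  qed
  have \<psi>_p: "\<psi> (?p u) = u \<and> ?p u \<in> V \<inter> D" if "u \<in> U" for u
  proof -
    obtain s a where u: "u = (s, a)" by (cases u)
    have p: "?p u \<in> D" "?p u \<in> gov a" "subvec C (?p u) = s"
      using char[of s a "?p u"] that u by auto
    have "g (?p u) \<noteq> 0" using that p_eq sU by (auto simp: U_def)
    with p \<psi>_\<phi>[of "?p u" a s] that u show ?thesis by (simp add: V_def W_def)
  qed
  \<comment> \<open>Here \<open>S\<close> is governed by its own recovered recurrence and has its
    own coordinates, so \<open>char\<close> identifies it with the parameterized series.\<close>
  have p_\<psi>: "?p (\<psi> S) = S \<and> \<psi> S \<in> U" if "S \<in> V \<inter> D" for S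
  proof -
    have S: "\<psi> S \<in> U" "g S \<noteq> 0" "S \<in> D" using that by (auto simp: V_def W_def)
    have "\<psi> S = (subvec C S, snd (\<psi> S))" by (simp add: \<psi>_def)
    then show ?thesis using char[of "subvec C S" "snd (\<psi> S)" S] \<psi>_gov[OF S(2,3)] S by metis
  qed
  have bij: "bij_betw ?p U (V \<inter> D)"
    by (rule bij_betw_byWitness[where f' = \<psi>]) (use \<psi>_p p_\<psi> in auto)
  have "inv_into U ?p S = \<psi> S" if "S \<in> V \<inter> D" for S
    using bij p_\<psi>[OF that] by (intro inv_into_f_eq) (auto simp: bij_betw_def)
  then have "smooth_on_subset (inv_into U ?p) (V \<inter> D)"
    by (intro smooth_on_subsetI[OF smooth_\<psi>]) (auto simp: V_def)
  moreover have "smooth_on_subset ?p U"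
    using sU p_eq by (intro smooth_on_subsetI[OF smooth_\<phi>]) auto
  ultimately have diffeo: "diffeomorphism_betw ?p U (V \<inter> D)"
    using bij by (simp add: diffeomorphism_betw_def)

  define k0 where "k0 = (subvec K a0 :: real^'r::{finite,linorder})"
  define s0 where "s0 = (subvec C S0 :: real^'r::{finite,linorder})"
  \<comment> \<open>Restoring the dropped coordinate is correct because entry \<open>\<tau>\<close>
    of \<open>a0\<close> is -1.\<close>
  have a0: "insert_minus_one \<tau> k0 = a0"
    using insert_minus_one_at[OF cm tau, of k0] subvec_insert_minus_one[OF cm tau, of k0] assms(8)
    by (intro vec_eqI_sel_K[OF cm tau]) (simp_all add: k0_def K_def r entry_def)
  have gov0: "gov k0 = governed_series TYPE('k) a0" by (simp add: gov_def a0)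
  have range0: "range ((*v) Z0) = gov k0"
    unfolding gov0 by (rule columns_basis_range[OF assms(11)])
  \<comment> \<open>This is where the invertibility hypothesis on \<open>Z0\<close> enters.\<close>
  have inj0: "w = 0" if "subvec C (Z0 *v w) = (0 :: real^'r::{finite,linorder})" for w
    using assms(12) that unfolding invertible_det_nz det_nonzero_iff_kernel
    by (simp add: subrows_mult C_def)
  \<comment> \<open>A solution of the homogeneous system is governed by \<open>a0\<close>, hence of
    the form \<open>Z0 *v w\<close>, and its \<open>C\<close>-coordinates vanish.\<close>
  have M0: "det (M k0) \<noteq> 0"
    unfolding det_nonzero_iff_kernel
  proof (intro allI impI)
    fix S assume "M k0 *v S = 0"
    moreover have "extend C (0 :: real^'r::{finite,linorder}) = (0 :: real^'n::{finite,linorder})"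
      by (simp add: extend_def vec_eq_iff)
    ultimately have S: "S \<in> gov k0" "subvec C S = (0 :: real^'r::{finite,linorder})"
      using sol[of k0 S 0] by auto
    then obtain w where "S = Z0 *v w" using range0 by blast
    with S inj0[of w] show "S = 0" by simp
  qed
  have col: "\<phi> (subvec C (column j Z0), k0) = column j Z0" for j
    using \<phi>_iff[OF M0, of "column j Z0"] range0
    by (metis matrix_vector_mult_basis rangeI)
  \<comment> \<open>A left kernel vector \<open>w\<close> makes \<open>Z0 *v w\<close> orthogonal to
    every column of \<open>Z0\<close>, hence to itself.\<close>
  have G0: "det (G k0) \<noteq> 0"
    unfolding det_nonzero_iff_left_kernel
  proof (intro allI impI)
    fix w assume w: "w v* G k0 = 0"
    have "w v* G k0 = (\<chi> j. (Z0 *v w) \<bullet> column j Z0)"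
      by (simp add: G_def col vec_eq_iff vector_matrix_mult_def matrix_mult_sum inner_sum_left
          scalar_mult_eq_scaleR)
    then have "(Z0 *v w) \<bullet> column j Z0 = 0" for j using w by (simp add: vec_eq_iff)
    then have "(Z0 *v w) \<bullet> (\<Sum>j\<in>UNIV. w $ j *s column j Z0) = 0"
      by (simp add: inner_sum_right scalar_mult_eq_scaleR)
    then have "Z0 *v w = 0" by (simp flip: matrix_mult_sum)
    then show "w = 0" using inj0[of w] subvec_0 by simp
  qed
  have S0: "S0 \<in> gov k0" "S0 \<in> D" using assms(9,10) by (simp_all add: gov0 D_def)
  have g0: "g S0 \<noteq> 0"
    unfolding g_def by (rule gram_nonzero[OF cm tau]) (use S0 in \<open>simp_all add: gov_def D_def r\<close>)
  \<comment> \<open>Turns \<open>g0\<close> into the last condition for the base point to lie in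
    \<open>U\<close>.\<close>
  have "\<phi> (s0, k0) = S0" using \<phi>_iff[OF M0, of S0 s0] S0 by (simp add: s0_def)
  then have U0: "(s0, k0) \<in> U" by (simp add: U_def U2_def U1_def M0 G0 g0)
  moreover have "S0 \<in> V"
    using U0 g0 \<psi>_\<phi>[OF g0 S0(1), of s0] by (simp add: V_def W_def s0_def)
  ultimately have "open U \<and> (subvec C S0, subvec K a0) \<in> U \<and> open V \<and> S0 \<in> V \<and>
      (\<forall>s a S. (s, a) \<in> U \<longrightarrow> (S = ?p (s, a) \<longleftrightarrow> S \<in> D \<and> S \<in> gov a \<and> subvec C S = s)) \<and>
      diffeomorphism_betw ?p U (V \<inter> D)"
    using U V char diffeo by (simp add: s0_def k0_def)
  then show ?thesis unfolding C_def K_def D_def gov_def by blast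
qed

end
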